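(* Let $L$ be a language with $L\in\mathrm{Alt}(f)$ for some $f:\mathbb{N}\to\mathbb{N}$. Then there exists a constant $C$ such that for all $n\in\mathbb{N}$, there exists a family of $C\cdot f(n)$ languages whose generated lattice contains all the left quotients of $L$ of order $n$.
   Context: For a language $L$ and word $u$, the left quotient is $u^{-1}L = \{v \mid uv\in L\}$; if $|u|\le n$ it is called a left quotient of $L$ of order $n$. A lattice of languages is a set of languages closed under (finite) union and intersection; the lattice generated by a family is the smallest lattice containing it. An alternating machine over a finite alphabet $A$ consists of a (possibly infinite) set of states $Q$, an initial state $q_0\in Q$, a transition function $\delta: Q\times A\to\mathcal{B}^+(Q)$ (positive boolean formulae over $Q$) and a set $F\subseteq Q$ of accepting states. For an input word $w$, the acceptance game $\mathcal{G}_{\mathcal{A},w}$ is played by Prover and Verifier: starting in $q_0$, the letters of $w$ are read from left to right; in state $q$ reading letter $a$, the next state is obtained from the formula $\delta(q,a)$, Prover resolving disjunctions and Verifier resolving conjunctions. Prover wins a play if it ends in a state of $F$. The word $w$ is accepted if Prover has a winning strategy; the language recognised is the set of accepted words. For $f:\mathbb{N}\to\mathbb{N}$, a language $L$ is in $\mathrm{Alt}(f)$ if there are an alternating machine recognising $L$ and a constant $C$ such that for all $n\in\mathbb{N}$, the number of states $q$ for which there exists a word $w$ of length at most $n$ with $q$ appearing in the game $\mathcal{G}_{\mathcal{A},w}$ is at most $C\cdot f(n)$. *)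

theory Defs
  imports Main "HOL.Hull"
begin

definition left_quotient :: "'a list \<Rightarrow> 'a list set \<Rightarrow> 'a list set" where
  "left_quotient u L = {v. u @ v \<in> L}"

definition left_quotients_of_order :: "nat \<Rightarrow> 'a list set \<Rightarrow> 'a list set set" where
  "left_quotients_of_order n L = {left_quotient u L |u. length u \<le> n}"

text \<open>Only binary unions and intersections are required, so the empty and the full language
  need not belong to a lattice.\<close>

definition lattice_of_languages :: "'a list set set \<Rightarrow> bool" where
  "lattice_of_languages \<L> \<longleftrightarrow> (\<forall>K\<in>\<L>. \<forall>L\<in>\<L>. K \<union> L \<in> \<L> \<and> K \<inter> L \<in> \<L>)"

definition generated_lattice :: "'a list set set \<Rightarrow> 'a list set set" where
  "generated_lattice \<G> = lattice_of_languages hull \<G>"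

text \<open>Positive boolean formulae have no constants for truth and falsity, so a play can always
  continue until the whole word has been read.\<close>

datatype (states_of: 's) pos_formula =
    State 's
  | Conj "'s pos_formula" "'s pos_formula"
  | Disj "'s pos_formula" "'s pos_formula"

record ('a, 's) machine =
  states :: "'s set"
  initial :: 's
  trans :: "'s \<Rightarrow> 'a \<Rightarrow> 's pos_formula"
  accepting :: "'s set"

definition alternating_machine :: "('a::finite, 's) machine \<Rightarrow> bool" where
  "alternating_machine M \<longleftrightarrow>
     initial M \<in> states M \<and>
     (\<forall>q\<in>states M. \<forall>a. states_of (trans M q a) \<subseteq> states M) \<and>
     accepting M \<subseteq> states M"

text \<open>A position consists of the formula still to be resolved and the suffix still to be read.
  The game is in state \<open>q\<close> when the formula is \<open>State q\<close>; the next letter then leads to the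
  formula given by the transition function, whose resolution yields the next state.\<close>

type_synonym ('a, 's) position = "'s pos_formula \<times> 'a list"

inductive move :: "('a, 's) machine \<Rightarrow> ('a, 's) position \<Rightarrow> ('a, 's) position \<Rightarrow> bool"
  for M where
  read: "move M (State q, a # v) (trans M q a, v)"
| conj_left: "move M (Conj \<phi> \<psi>, v) (\<phi>, v)"
| conj_right: "move M (Conj \<phi> \<psi>, v) (\<psi>, v)"
| disj_left: "move M (Disj \<phi> \<psi>, v) (\<phi>, v)"
| disj_right: "move M (Disj \<phi> \<psi>, v) (\<psi>, v)"

definition prover_position :: "('a, 's) position \<Rightarrow> bool" where
  "prover_position p \<longleftrightarrow> (\<exists>\<phi> \<psi> v. p = (Disj \<phi> \<psi>, v))"

text \<open>Plays are possibly partial; a complete play is one that has reached a state with no letter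
  left to read.\<close>

definition play :: "('a, 's) machine \<Rightarrow> 'a list \<Rightarrow> ('a, 's) position list \<Rightarrow> bool" where
  "play M w h \<longleftrightarrow> h \<noteq> [] \<and> hd h = (State (initial M), w) \<and> successively (move M) h"

definition complete_play :: "('a, 's) machine \<Rightarrow> 'a list \<Rightarrow> ('a, 's) position list \<Rightarrow> bool" where
  "complete_play M w h \<longleftrightarrow> play M w h \<and> (\<exists>q. last h = (State q, []))"

definition prover_wins :: "('a, 's) machine \<Rightarrow> ('a, 's) position list \<Rightarrow> bool" where
  "prover_wins M h \<longleftrightarrow> (\<exists>q\<in>accepting M. last h = (State q, []))"

text \<open>A strategy may depend on the whole history, and must always prescribe a legal move: an
  illegal one would leave no play to follow it and make the strategy winning vacuously.\<close>

definition prover_strategy ::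
    "('a, 's) machine \<Rightarrow> 'a list \<Rightarrow> (('a, 's) position list \<Rightarrow> ('a, 's) position) \<Rightarrow> bool" where
  "prover_strategy M w \<sigma> \<longleftrightarrow>
     (\<forall>h. play M w h \<and> prover_position (last h) \<longrightarrow> move M (last h) (\<sigma> h))"

definition follows ::
    "(('a, 's) position list \<Rightarrow> ('a, 's) position) \<Rightarrow> ('a, 's) position list \<Rightarrow> bool" where
  "follows \<sigma> h \<longleftrightarrow>
     (\<forall>i. Suc i < length h \<and> prover_position (h ! i) \<longrightarrow> h ! Suc i = \<sigma> (take (Suc i) h))"

definition accepts :: "('a, 's) machine \<Rightarrow> 'a list \<Rightarrow> bool" where
  "accepts M w \<longleftrightarrow>
     (\<exists>\<sigma>. prover_strategy M w \<sigma> \<and>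
        (\<forall>h. complete_play M w h \<and> follows \<sigma> h \<longrightarrow> prover_wins M h))"

definition language :: "('a, 's) machine \<Rightarrow> 'a list set" where
  "language M = {w. accepts M w}"

definition appears :: "('a, 's) machine \<Rightarrow> 'a list \<Rightarrow> 's \<Rightarrow> bool" where
  "appears M w q \<longleftrightarrow> (\<exists>h v. play M w h \<and> (State q, v) \<in> set h)"

definition states_upto :: "('a, 's) machine \<Rightarrow> nat \<Rightarrow> 's set" where
  "states_upto M n = {q. \<exists>w. length w \<le> n \<and> appears M w q}"

text \<open>The type argument is the type from which the states of the machine are drawn. Finiteness is
  explicit because the cardinality of an infinite set is \<open>0\<close>.\<close>

definition Alt :: "'s itself \<Rightarrow> (nat \<Rightarrow> nat) \<Rightarrow> 'a::finite list set set" where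
  "Alt _ f =
     {L. \<exists>(M :: ('a, 's) machine) (C :: nat).
           alternating_machine M \<and> language M = L \<and>
           (\<forall>n. finite (states_upto M n) \<and> card (states_upto M n) \<le> C * f n)}"

end

theory Submission imports Defs begin

text \<open>By determinacy of the finite acceptance game, a word is accepted iff the evaluation of the
  initial position along the game tree is true. For a word \<open>u @ v\<close> with \<open>length u \<le> n\<close>, the first
  \<open>length u\<close> rounds of this evaluation form a positive boolean combination, independent of \<open>v\<close>, of
  the statements that \<open>v\<close> is accepted from \<open>q\<close>, where \<open>q\<close> ranges over the states reachable within
  \<open>n\<close> letters. Hence every left quotient of order \<open>n\<close> lies in the lattice generated by the
  languages recognised from these states.\<close>

text \<open>Backward evaluation of the game, free of strategies. The recursion terminates
  lexicographically: reading shortens the word, and every other step keeps the word and shrinks the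
  formula.\<close>

fun wins :: "('a, 's) machine \<Rightarrow> 's pos_formula \<Rightarrow> 'a list \<Rightarrow> bool" where
  "wins M (State q) [] \<longleftrightarrow> q \<in> accepting M"
| "wins M (State q) (a # v) \<longleftrightarrow> wins M (trans M q a) v"
| "wins M (Conj \<phi> \<psi>) v \<longleftrightarrow> wins M \<phi> v \<and> wins M \<psi> v"
| "wins M (Disj \<phi> \<psi>) v \<longleftrightarrow> wins M \<phi> v \<or> wins M \<psi> v"

definition language_from :: "('a, 's) machine \<Rightarrow> 's \<Rightarrow> 'a list set" where
  "language_from M q = {v. wins M (State q) v}"

lemma play_initial: "play M w [(State (initial M), w)]"
  by (simp add: play_def)

lemma play_snoc:
  assumes "play M w h" "move M (last h) p"
  shows "play M w (h @ [p])"
  using assms by (auto simp: play_def successively_append_iff)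

lemma play_snocD:
  assumes "play M w (h @ [p])" "h \<noteq> []"
  shows "play M w h" "move M (last h) p"
  using assms by (auto simp: play_def successively_append_iff)

lemma follows_singleton: "follows \<sigma> [p]"
  by (simp add: follows_def)

text \<open>The only new index is that of \<open>last h\<close>, where the history shown to the
  strategy is all of \<open>h\<close>.\<close>

lemma follows_snoc_iff:
  assumes "h \<noteq> []"
  shows "follows \<sigma> (h @ [p]) \<longleftrightarrow> follows \<sigma> h \<and> (prover_position (last h) \<longrightarrow> p = \<sigma> h)"
proof -
  obtain n where n: "length h = Suc n"
    using assms by (cases h) auto
  have "follows \<sigma> (h @ [p]) \<longleftrightarrow>
      (\<forall>i\<le>n. prover_position (h ! i) \<longrightarrow> (h @ [p]) ! Suc i = \<sigma> (take (Suc i) h))"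
    by (auto simp: follows_def n nth_append less_Suc_eq_le)
  also have "\<dots> \<longleftrightarrow>
      (\<forall>i<n. prover_position (h ! i) \<longrightarrow> h ! Suc i = \<sigma> (take (Suc i) h)) \<and>
      (prover_position (h ! n) \<longrightarrow> p = \<sigma> h)"
    using n by (auto simp: le_less nth_append)
  finally show ?thesis
    using n assms by (auto simp: follows_def last_conv_nth)
qed

text \<open>Positional: only the last position matters. When neither disjunct wins it still makes a
  legal move, as \<open>prover_strategy\<close> demands.\<close>

definition choose_winning :: "('a, 's) machine \<Rightarrow> ('a, 's) position list \<Rightarrow> ('a, 's) position" where
  "choose_winning M h =
     (case last h of
        (Disj \<phi> \<psi>, v) \<Rightarrow> if wins M \<phi> v then (\<phi>, v) else (\<psi>, v)
      | p \<Rightarrow> p)"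

lemma prover_strategy_choose_winning: "prover_strategy M w (choose_winning M)"
  by (auto simp: prover_strategy_def prover_position_def choose_winning_def
      intro: move.intros)

text \<open>Winning is an invariant: reading preserves it, a winning conjunction has two winning
  conjuncts, and at a disjunction the strategy picks a winning disjunct.\<close>

lemma wins_along_choose_winning:
  assumes "play M w h" "follows (choose_winning M) h" "wins M (State (initial M)) w"
  shows "case_prod (wins M) (last h)"
  using assms
proof (induction h rule: rev_induct)
  case Nil
  then show ?case by (simp add: play_def)
next
  case (snoc p h)
  show ?case
  proof (cases "h = []")
    case True
    then show ?thesis using snoc.prems by (simp add: play_def)
  next
    case False
    have "move M (last h) p" "case_prod (wins M) (last h)"
      "prover_position (last h) \<longrightarrow> p = choose_winning M h"
      using snoc False play_snocD[of M w h p] by (auto simp: follows_snoc_iff)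
    then show ?thesis
      by (cases rule: move.cases) (auto simp: prover_position_def choose_winning_def
          split: if_splits)
  qed
qed

text \<open>The other half of determinacy. Verifier answers a losing conjunction with a losing
  conjunct; both disjuncts of a losing disjunction lose, so no choice of \<open>\<sigma>\<close>
  helps. The recursion of \<open>wins\<close> brings the play to completion.\<close>

lemma losing_play_exists:
  assumes "prover_strategy M w \<sigma>"
    and "play M w h" "follows \<sigma> h" "last h = (\<phi>, v)" "\<not> wins M \<phi> v"
  shows "\<exists>h. complete_play M w h \<and> follows \<sigma> h \<and> \<not> prover_wins M h"
  using assms
proof (induction M \<phi> v arbitrary: h rule: wins.induct)
  case (1 M q)
  then show ?case by (auto simp: complete_play_def prover_wins_def)
next
  case (2 M q a v)
  have "h \<noteq> []" using "2.prems" by (auto simp: play_def)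
  then show ?case
    using "2.prems" by (intro "2.IH"[of "h @ [(trans M q a, v)]"])
      (auto simp: play_snoc move.intros follows_snoc_iff prover_position_def)
next
  case (3 M \<phi> \<psi> v)
  have "h \<noteq> []" using "3.prems" by (auto simp: play_def)
  then have "play M w (h @ [p]) \<and> follows \<sigma> (h @ [p])" if "p \<in> {(\<phi>, v), (\<psi>, v)}" for p
    using "3.prems" that by (auto simp: play_snoc move.intros follows_snoc_iff prover_position_def)
  then show ?case
    using "3.IH"(1)[of "h @ [(\<phi>, v)]"] "3.IH"(2)[of "h @ [(\<psi>, v)]"] "3.prems" by auto
next
  case (4 M \<phi> \<psi> v)
  have "h \<noteq> []" using "4.prems" by (auto simp: play_def)
  \<comment> \<open>Legality confines \<open>\<sigma> h\<close> to the two disjuncts, to which the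
    induction hypotheses apply.\<close>
  have "move M (last h) (\<sigma> h)"
    using "4.prems" by (auto simp: prover_strategy_def prover_position_def)
  moreover have "follows \<sigma> (h @ [\<sigma> h])"
    using "4.prems" \<open>h \<noteq> []\<close> by (simp add: follows_snoc_iff)
  ultimately have next_play: "play M w (h @ [\<sigma> h])" "follows \<sigma> (h @ [\<sigma> h])"
    "\<sigma> h \<in> {(\<phi>, v), (\<psi>, v)}"
    using "4.prems" by (auto simp: play_snoc elim: move.cases)
  then show ?case
    using "4.IH"[of "h @ [\<sigma> h]"] "4.prems" by auto
qed

lemma accepts_iff_wins: "accepts M w \<longleftrightarrow> wins M (State (initial M)) w"
proof
  assume "accepts M w"
  then show "wins M (State (initial M)) w"
    unfolding accepts_def by (metis losing_play_exists play_initial follows_singleton last.simps)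
next
  assume "wins M (State (initial M)) w"
  then have "prover_wins M h" if "complete_play M w h" "follows (choose_winning M) h" for h
    using wins_along_choose_winning[of M w h] that
    by (auto simp: complete_play_def prover_wins_def)
  then show "accepts M w"
    using prover_strategy_choose_winning by (auto simp: accepts_def)
qed

lemma generated_lattice_Un:
  "K \<in> generated_lattice \<G> \<Longrightarrow> L \<in> generated_lattice \<G> \<Longrightarrow> K \<union> L \<in> generated_lattice \<G>"
  by (auto simp: generated_lattice_def hull_def lattice_of_languages_def)

lemma generated_lattice_Int:
  "K \<in> generated_lattice \<G> \<Longrightarrow> L \<in> generated_lattice \<G> \<Longrightarrow> K \<inter> L \<in> generated_lattice \<G>"
  by (auto simp: generated_lattice_def hull_def lattice_of_languages_def)

lemma generated_lattice_base: "K \<in> \<G> \<Longrightarrow> K \<in> generated_lattice \<G>"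
  by (simp add: generated_lattice_def hull_inc)

text \<open>Evaluation over the unread part \<open>u\<close> of \<open>w\<close> turns conjunctions
  into intersections and disjunctions into unions, until only languages of single states
  remain.\<close>

lemma quotient_of_position_in_generated_lattice:
  assumes "play M w h" "last h = (\<phi>, u)" "length w \<le> n"
  shows "{v. wins M \<phi> (u @ v)} \<in> generated_lattice (language_from M ` states_upto M n)"
  using assms
proof (induction M \<phi> u arbitrary: h rule: wins.induct)
  case (1 M q)
  \<comment> \<open>With \<open>u\<close> used up, \<open>q\<close> ends a play on \<open>w\<close>
    itself, so \<open>w\<close> witnesses that \<open>q\<close> is in
    \<open>states_upto M n\<close>.\<close>
  then have "(State q, []) \<in> set h"
    by (metis last_in_set play_def)
  then have "q \<in> states_upto M n"
    using 1 by (auto simp: states_upto_def appears_def)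
  then have "language_from M q \<in> generated_lattice (language_from M ` states_upto M n)"
    by (intro generated_lattice_base) auto
  then show ?case by (simp add: language_from_def)
next
  case (2 M q a v)
  then show ?case
    using "2.IH"[of "h @ [(trans M q a, v)]"] by (simp add: play_snoc move.intros)
next
  case (3 M \<phi> \<psi> v)
  then have "{x. wins M \<phi> (v @ x)} \<inter> {x. wins M \<psi> (v @ x)}
      \<in> generated_lattice (language_from M ` states_upto M n)"
    using "3.IH"(1)[of "h @ [(\<phi>, v)]"] "3.IH"(2)[of "h @ [(\<psi>, v)]"]
    by (intro generated_lattice_Int) (simp_all add: play_snoc move.intros)
  then show ?case by (simp add: Int_def)
next
  case (4 M \<phi> \<psi> v)
  then have "{x. wins M \<phi> (v @ x)} \<union> {x. wins M \<psi> (v @ x)}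
      \<in> generated_lattice (language_from M ` states_upto M n)"
    using "4.IH"(1)[of "h @ [(\<phi>, v)]"] "4.IH"(2)[of "h @ [(\<psi>, v)]"]
    by (intro generated_lattice_Un) (simp_all add: play_snoc move.intros)
  then show ?case by (simp add: Un_def)
qed

lemma initial_in_states_upto: "initial M \<in> states_upto M n"
  unfolding states_upto_def appears_def
  using play_initial[of M "[]"] by (intro CollectI exI[of _ "[]"]) fastforce

lemma left_quotients_in_generated_lattice:
  "left_quotients_of_order n (language M)
     \<subseteq> generated_lattice (language_from M ` states_upto M n)"
proof
  fix K assume "K \<in> left_quotients_of_order n (language M)"
  then obtain u where "length u \<le> n" "K = {v. wins M (State (initial M)) (u @ v)}"
    by (auto simp: left_quotients_of_order_def left_quotient_def language_def accepts_iff_wins)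
  \<comment> \<open>Taken at the one-position play on \<open>u\<close>, whose unread part is all of
    \<open>u\<close>.\<close>
  then show "K \<in> generated_lattice (language_from M ` states_upto M n)"
    using quotient_of_position_in_generated_lattice[OF play_initial, of M u] by simp
qed

text \<open>Turns a bound on the number of states into a family with exactly \<open>m\<close>
  indices; repetitions fill the surplus, so the set of generators stays the same.\<close>

lemma image_eq_image_lessThan:
  assumes "finite A" "A \<noteq> {}" "card A \<le> m"
  shows "\<exists>g :: nat \<Rightarrow> 'b. g ` {..<m} = k ` A"
proof -
  obtain e where e: "bij_betw e {..<card A} A"
    using ex_bij_betw_nat_finite[OF assms(1)] by (auto simp: atLeast0LessThan)
  obtain a where "a \<in> A" using assms(2) by auto
  \<comment> \<open>Indices from \<open>card A\<close> on all go to the fixed element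
    \<open>a\<close>.\<close>
  define g where "g i = (if i < card A then e i else a)" for i
  have "g ` {..<m} = A"
  proof
    show "g ` {..<m} \<subseteq> A"
      using e \<open>a \<in> A\<close> by (auto simp: g_def bij_betw_def)
    have "A = g ` {..<card A}"
      using e by (auto simp: g_def bij_betw_def)
    also have "\<dots> \<subseteq> g ` {..<m}"
      using assms(3) by (intro image_mono) auto
    finally show "A \<subseteq> g ` {..<m}" .
  qed
  then show ?thesis by (metis image_image)
qed

theorem theorem2:
  fixes L :: "'a::finite list set" and f :: "nat \<Rightarrow> nat"
  assumes "L \<in> Alt TYPE('s) f"
  shows "\<exists>C::nat. \<forall>n. \<exists>G :: nat \<Rightarrow> 'a list set.
           left_quotients_of_order n L \<subseteq> generated_lattice (G ` {..<C * f n})"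
proof -
  obtain M :: "('a, 's) machine" and C :: nat where L: "language M = L"
    and fin: "\<And>n. finite (states_upto M n)" and card: "\<And>n. card (states_upto M n) \<le> C * f n"
    using assms by (auto simp: Alt_def)
  have "\<exists>G :: nat \<Rightarrow> 'a list set.
      left_quotients_of_order n L \<subseteq> generated_lattice (G ` {..<C * f n})" for n
    \<comment> \<open>The constant of \<open>Alt\<close> serves unchanged; the initial state
      provides the nonemptiness that the padding requires.\<close>
    using image_eq_image_lessThan[OF fin _ card, of n "language_from M"]
      left_quotients_in_generated_lattice[of n M] initial_in_states_upto[of M n]
    by (metis L empty_iff)
  then show ?thesis by blast
qed

end
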